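(* Let $q$ be a prime number and let $G$ be a finitely generated group such that every finite quotient of $G$ has order prime to $q$. Then $G$ has vanishing virtual first Betti number.
   Context: A group $G$ has vanishing virtual first Betti number if every finite-index subgroup $H \leq G$ has first Betti number zero, i.e. no finite-index subgroup $H$ of $G$ admits a surjective homomorphism $H \to \mathbb{Z}$. *)

theory Defs
  imports "HOL-Algebra.Elementary_Groups" "HOL-Computational_Algebra.Primes"
begin

definition finitely_generated_group :: "('a, 'b) monoid_scheme \<Rightarrow> bool" where
  "finitely_generated_group G \<longleftrightarrow>
     group G \<and> (\<exists>S. finite S \<and> S \<subseteq> carrier G \<and> generate G S = carrier G)"

definition finite_index_subgroup :: "'a set \<Rightarrow> ('a, 'b) monoid_scheme \<Rightarrow> bool" where
  "finite_index_subgroup H G \<longleftrightarrow> subgroup H G \<and> finite (rcosets\<^bsub>G\<^esub> H)"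

text \<open>Vanishing of the first Betti number is taken to mean that there is no epimorphism onto
  the infinite cyclic group. For finitely generated groups this is the same as
  the abelianization having rank zero.\<close>

definition vanishing_first_betti :: "('a, 'b) monoid_scheme \<Rightarrow> bool" where
  "vanishing_first_betti G \<longleftrightarrow> epi G integer_group = {}"

definition vanishing_virtual_first_betti :: "('a, 'b) monoid_scheme \<Rightarrow> bool" where
  "vanishing_virtual_first_betti G \<longleftrightarrow>
     (\<forall>H. finite_index_subgroup H G \<longrightarrow> vanishing_first_betti (G\<lparr>carrier := H\<rparr>))"

end

theory Submission
  imports Defs "HOL-Algebra.Multiplicative_Group"
begin

text \<open>
  Suppose that a finite-index subgroup \<open>H\<close> has an epimorphism \<open>f\<close> onto \<open>\<int>\<close>. The subgroup
  \<open>K = f\<^sup>-\<^sup>1(q\<int>)\<close> has finite index in \<open>H\<close>, hence in \<open>G\<close>, so its normal core \<open>N\<close> in \<open>G\<close> has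
  finite index as well. Choose \<open>t \<in> H\<close> with \<open>f t = 1\<close> and put \<open>n = |G/N|\<close>. By Lagrange,
  \<open>t\<^sup>n \<in> N \<subseteq> K\<close>, and therefore \<open>n = f (t\<^sup>n)\<close> is a multiple of \<open>q\<close>: the finite quotient
  \<open>G/N\<close> has order divisible by \<open>q\<close>. Using the single element \<open>t\<close> in this way, no index
  has to be computed; only finiteness of the indices of \<open>K\<close> and \<open>N\<close> matters.

  Both finiteness statements about \<open>G\<close> come from one principle
  (\<open>finite_rcosets_if_finite_invariant\<close>): a subgroup has finite index as soon as some function
  on the group with finitely many values separates its right cosets. It is applied to \<open>K\<close> in
  \<open>finite_rcosets_tower\<close> and to the core in \<open>finite_rcosets_normal_core\<close>.
\<close>

section \<open>Subgroups of finite index\<close>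

lemma (in group) inv_mult_cancel_left:
  assumes "x \<in> carrier G" "y \<in> carrier G"
  shows "inv x \<otimes> (x \<otimes> y) = y"
  using assms by (simp add: m_assoc[symmetric])

lemma (in group) rcos_eq_iff:
  assumes "subgroup K G" "x \<in> carrier G" "y \<in> carrier G"
  shows "K #> x = K #> y \<longleftrightarrow> x \<otimes> inv y \<in> K"
proof
  assume "K #> x = K #> y"
  then have "x \<in> K #> y" using rcos_self[OF assms(2,1)] by simp
  then show "x \<otimes> inv y \<in> K"
    by (rule subgroup.rcos_module_imp[OF assms(1) is_group assms(3)])
next
  assume "x \<otimes> inv y \<in> K"
  then have "x \<in> K #> y"
    by (rule subgroup.rcos_module_rev[OF assms(1) is_group assms(3,2)])
  then show "K #> x = K #> y"
    using repr_independence[OF _ assms(3,1)] by simp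
qed

text \<open>The values of \<open>F\<close> are labels for right cosets: equal labels force equal cosets, so there
  are at most as many cosets as labels. A coset may carry several labels.\<close>

lemma (in group) finite_rcosets_if_finite_invariant:
  assumes K: "subgroup K G" and fin: "finite (F ` carrier G)"
    and sep: "\<And>x y. \<lbrakk>x \<in> carrier G; y \<in> carrier G; F x = F y\<rbrakk> \<Longrightarrow> x \<otimes> inv y \<in> K"
  shows "finite (rcosets K)"
proof -
  define r where "r v = (SOME x. x \<in> carrier G \<and> F x = v)" for v
  have "K #> x \<in> (\<lambda>v. K #> r v) ` F ` carrier G" if x: "x \<in> carrier G" for x
  proof -
    have "r (F x) \<in> carrier G \<and> F (r (F x)) = F x"
      unfolding r_def by (rule someI[of _ x]) (use x in simp)
    then have "K #> x = K #> r (F x)"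
      using sep[of x "r (F x)"] x rcos_eq_iff[OF K] by simp
    then show ?thesis using x by blast
  qed
  then have "rcosets K \<subseteq> (\<lambda>v. K #> r v) ` F ` carrier G"
    by (auto simp: RCOSETS_def)
  then show ?thesis using fin by (meson finite_imageI finite_subset)
qed

text \<open>Fix a representative of every right coset of \<open>H\<close>. An element \<open>x\<close> is \<open>h \<otimes> r\<close> with \<open>r\<close>
  the representative of \<open>H #> x\<close>, and the pair of \<open>H #> x\<close> and \<open>K #> h\<close> determines \<open>K #> x\<close>.
  The subgroup \<open>H\<close> enters the second premise only through its elements, so that the cosets of
  \<open>K\<close> can be taken in \<open>G\<close>.\<close>

lemma (in group) finite_rcosets_tower:
  assumes K: "subgroup K G" and H: "subgroup H G"
    and finH: "finite (rcosets H)" and finK: "finite ((\<lambda>h. K #> h) ` H)"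
  shows "finite (rcosets K)"
proof -
  define r where "r C = (SOME x. x \<in> carrier G \<and> H #> x = C)" for C
  have r: "r (H #> x) \<in> carrier G \<and> H #> r (H #> x) = H #> x" if "x \<in> carrier G" for x
    unfolding r_def by (rule someI[of _ x]) (use that in simp)
  have h: "x \<otimes> inv (r (H #> x)) \<in> H" if "x \<in> carrier G" for x
    using r[OF that] that rcos_eq_iff[OF H, of x "r (H #> x)"] by simp
  show ?thesis
  proof (rule finite_rcosets_if_finite_invariant[OF K,
        where F = "\<lambda>x. (H #> x, K #> (x \<otimes> inv (r (H #> x))))"])
    have "(\<lambda>x. (H #> x, K #> (x \<otimes> inv (r (H #> x))))) ` carrier G
        \<subseteq> (rcosets H) \<times> (\<lambda>h. K #> h) ` H"
      using h by (auto simp: RCOSETS_def)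
    then show "finite ((\<lambda>x. (H #> x, K #> (x \<otimes> inv (r (H #> x))))) ` carrier G)"
      using finH finK by (meson finite_SigmaI finite_subset)
  next
    fix x y
    assume x: "x \<in> carrier G" and y: "y \<in> carrier G"
      and "(H #> x, K #> (x \<otimes> inv (r (H #> x)))) = (H #> y, K #> (y \<otimes> inv (r (H #> y))))"
    then have Hxy: "H #> x = H #> y"
      and Kxy: "K #> (x \<otimes> inv (r (H #> x))) = K #> (y \<otimes> inv (r (H #> y)))"
      by blast+
    have eq: "K #> (x \<otimes> inv (r (H #> x))) = K #> (y \<otimes> inv (r (H #> x)))"
      using Kxy unfolding Hxy .
    have rx: "r (H #> x) \<in> carrier G" using r[OF x] by simp
    have "(x \<otimes> inv (r (H #> x))) \<otimes> inv (y \<otimes> inv (r (H #> x))) \<in> K"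
      using eq x y rx rcos_eq_iff[OF K] by simp
    also have "(x \<otimes> inv (r (H #> x))) \<otimes> inv (y \<otimes> inv (r (H #> x))) = x \<otimes> inv y"
      using x y rx by (simp add: inv_mult_group m_assoc inv_mult_cancel_left)
    finally show "x \<otimes> inv y \<in> K" .
  qed
qed

definition normal_core :: "('a, 'b) monoid_scheme \<Rightarrow> 'a set \<Rightarrow> 'a set" where
  "normal_core G K =
     {g \<in> carrier G. \<forall>x\<in>carrier G. x \<otimes>\<^bsub>G\<^esub> g \<otimes>\<^bsub>G\<^esub> inv\<^bsub>G\<^esub> x \<in> K}"

lemma (in group) normal_core_subset:
  assumes "subgroup K G"
  shows "normal_core G K \<subseteq> K"
proof
  fix g
  assume "g \<in> normal_core G K"
  then have "g \<in> carrier G" "\<one> \<otimes> g \<otimes> inv \<one> \<in> K"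
    unfolding normal_core_def by blast+
  then show "g \<in> K" by simp
qed

lemma (in group) normal_core_normal:
  assumes K: "subgroup K G"
  shows "normal_core G K \<lhd> G"
proof -
  have "subgroup (normal_core G K) G"
  proof (rule subgroupI)
    show "normal_core G K \<subseteq> carrier G" by (auto simp: normal_core_def)
    have "\<one> \<in> normal_core G K"
      using subgroup.one_closed[OF K] by (simp add: normal_core_def)
    then show "normal_core G K \<noteq> {}" by blast
  next
    fix g assume "g \<in> normal_core G K"
    then have g: "g \<in> carrier G" "\<And>x. x \<in> carrier G \<Longrightarrow> x \<otimes> g \<otimes> inv x \<in> K"
      by (auto simp: normal_core_def)
    have "x \<otimes> inv g \<otimes> inv x \<in> K" if x: "x \<in> carrier G" for x
    proof -
      have "inv (x \<otimes> g \<otimes> inv x) \<in> K"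
        using g(2)[OF x] subgroup.m_inv_closed[OF K] by blast
      then show ?thesis using g(1) x by (simp add: inv_mult_group m_assoc)
    qed
    then show "inv g \<in> normal_core G K" using g(1) by (simp add: normal_core_def)
  next
    fix g k assume "g \<in> normal_core G K" "k \<in> normal_core G K"
    then have g: "g \<in> carrier G" "\<And>x. x \<in> carrier G \<Longrightarrow> x \<otimes> g \<otimes> inv x \<in> K"
      and k: "k \<in> carrier G" "\<And>x. x \<in> carrier G \<Longrightarrow> x \<otimes> k \<otimes> inv x \<in> K"
      by (auto simp: normal_core_def)
    have "x \<otimes> (g \<otimes> k) \<otimes> inv x \<in> K" if x: "x \<in> carrier G" for x
    proof -
      have "(x \<otimes> g \<otimes> inv x) \<otimes> (x \<otimes> k \<otimes> inv x) \<in> K"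
        using g(2)[OF x] k(2)[OF x] subgroup.m_closed[OF K] by blast
      also have "(x \<otimes> g \<otimes> inv x) \<otimes> (x \<otimes> k \<otimes> inv x) = x \<otimes> (g \<otimes> k) \<otimes> inv x"
        using g(1) k(1) x by (simp add: m_assoc inv_mult_cancel_left)
      finally show ?thesis .
    qed
    then show "g \<otimes> k \<in> normal_core G K" using g(1) k(1) by (simp add: normal_core_def)
  qed
  moreover have "y \<otimes> g \<otimes> inv y \<in> normal_core G K"
    if y: "y \<in> carrier G" and "g \<in> normal_core G K" for y g
  proof -
    have g: "g \<in> carrier G" "\<And>x. x \<in> carrier G \<Longrightarrow> x \<otimes> g \<otimes> inv x \<in> K"
      using that(2) by (auto simp: normal_core_def)
    have "x \<otimes> (y \<otimes> g \<otimes> inv y) \<otimes> inv x \<in> K" if x: "x \<in> carrier G" for x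
      using g(2)[of "x \<otimes> y"] g(1) x y by (simp add: inv_mult_group m_assoc)
    then show ?thesis using g(1) y by (simp add: normal_core_def)
  qed
  ultimately show ?thesis by (simp add: normal_inv_iff)
qed

text \<open>\<open>G\<close> permutes the finite set of right cosets of \<open>K\<close> by right multiplication, and the core
  is the kernel of this action. The permutation induced by an element therefore determines its
  coset modulo the core, and there are finitely many permutations.\<close>

lemma (in group) finite_rcosets_normal_core:
  assumes K: "subgroup K G" and fin: "finite (rcosets K)"
  shows "finite (rcosets (normal_core G K))"
proof (rule finite_rcosets_if_finite_invariant[where F = "\<lambda>g. \<lambda>C\<in>rcosets K. C #> g"])
  show "subgroup (normal_core G K) G"
    using normal_core_normal[OF K] by (rule normal_imp_subgroup)
  have sub: "K \<subseteq> carrier G" using K by (rule subgroup.subset)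
  have "C #> g \<in> rcosets K" if "C \<in> rcosets K" "g \<in> carrier G" for C g
    using that rcosetsI[OF sub] by (auto simp: RCOSETS_def coset_mult_assoc[OF sub])
  then have "(\<lambda>g. \<lambda>C\<in>rcosets K. C #> g) ` carrier G \<subseteq> (rcosets K) \<rightarrow>\<^sub>E (rcosets K)"
    by auto
  then show "finite ((\<lambda>g. \<lambda>C\<in>rcosets K. C #> g) ` carrier G)"
    using fin by (meson finite_PiE finite_subset)
  fix g k
  assume g: "g \<in> carrier G" and k: "k \<in> carrier G"
    and eq: "(\<lambda>C\<in>rcosets K. C #> g) = (\<lambda>C\<in>rcosets K. C #> k)"
  have "x \<otimes> (g \<otimes> inv k) \<otimes> inv x \<in> K" if x: "x \<in> carrier G" for x
  proof -
    have "K #> x \<in> rcosets K" using x by (auto simp: RCOSETS_def)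
    then have "K #> x #> g = K #> x #> k" using fun_cong[OF eq, of "K #> x"] by simp
    then have "K #> (x \<otimes> g) = K #> (x \<otimes> k)" using x g k by (simp add: coset_mult_assoc[OF sub])
    then have "(x \<otimes> g) \<otimes> inv (x \<otimes> k) \<in> K" using x g k rcos_eq_iff[OF K] by simp
    then show ?thesis using x g k by (simp add: inv_mult_group m_assoc)
  qed
  then show "g \<otimes> inv k \<in> normal_core G K" using g k by (simp add: normal_core_def)
qed

lemma (in normal) pow_order_FactGroup_mem:
  assumes fin: "finite (carrier (G Mod H))" and x: "x \<in> carrier G"
  shows "x [^] order (G Mod H) \<in> H"
proof -
  interpret Q: group "G Mod H" by (rule factorgroup_is_group)
  interpret p: group_hom G "G Mod H" "\<lambda>x. H #> x"
    by unfold_locales (rule r_coset_hom_Mod)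
  have "H #> (x [^] order (G Mod H)) = (H #> x) [^]\<^bsub>G Mod H\<^esub> order (G Mod H)"
    using x by (rule p.hom_nat_pow)
  also have "\<dots> = \<one>\<^bsub>G Mod H\<^esub>"
    using p.hom_closed[OF x] by (rule Q.pow_order_eq_1)
  finally have "H #> (x [^] order (G Mod H)) = H" by simp
  then show ?thesis using x rcos_self[OF nat_pow_closed[OF x] is_subgroup] by metis
qed

section \<open>Homomorphisms to the integers\<close>

lemma (in group) preimage_multiples_finite_index:
  fixes f :: "'a \<Rightarrow> int" and q :: nat
  assumes H: "subgroup H G" and fin: "finite (rcosets H)"
    and f: "f \<in> hom (G\<lparr>carrier := H\<rparr>) integer_group" and q: "q > 0"
  shows "subgroup {h \<in> H. int q dvd f h} G" (is "subgroup ?K G")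
    and "finite (rcosets {h \<in> H. int q dvd f h})"
proof -
  interpret f: group_hom "G\<lparr>carrier := H\<rparr>" integer_group f
    by (simp add: group_hom_def group_hom_axioms_def subgroup_imp_group[OF H] f)
  have mult: "f (h \<otimes> k) = f h + f k" if "h \<in> H" "k \<in> H" for h k
    using f.hom_mult[of h k] that by simp
  have inv: "f (inv h) = - f h" if "h \<in> H" for h
    using f.hom_inv[of h] that by (simp add: m_inv_consistent[OF H])
  show K: "subgroup ?K G"
  proof (rule subgroupI)
    show "?K \<subseteq> carrier G" using subgroup.subset[OF H] by blast
    show "?K \<noteq> {}" using subgroup.one_closed[OF H] f.hom_one by auto
    show "inv a \<in> ?K" if "a \<in> ?K" for a
      using that by (simp add: inv subgroup.m_inv_closed[OF H])
    show "a \<otimes> b \<in> ?K" if "a \<in> ?K" "b \<in> ?K" for a b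
      using that by (simp add: mult subgroup.m_closed[OF H])
  qed
  show "finite (rcosets ?K)"
  proof (rule finite_rcosets_tower[OF K H fin])
    \<comment> \<open>The cosets of the preimage in \<open>H\<close> are residue classes of \<open>f\<close>, at most \<open>q\<close> in number.\<close>
    have "?K #> h = {k \<in> H. f k mod int q = f h mod int q}" if h: "h \<in> H" for h
    proof -
      have "k \<in> ?K #> h \<longleftrightarrow> k \<in> H \<and> f k mod int q = f h mod int q" for k
      proof -
        have "k \<in> H" if "k \<in> ?K #> h"
          using that h subgroup.m_closed[OF H] by (auto simp: r_coset_def)
        moreover have "k \<in> ?K #> h \<longleftrightarrow> f k mod int q = f h mod int q" if k: "k \<in> H"
        proof -
          have "k \<in> ?K #> h \<longleftrightarrow> k \<otimes> inv h \<in> ?K"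
            using subgroup.rcos_module[OF K is_group] h k subgroup.subset[OF H] by blast
          then show ?thesis
            using h k by (simp add: mult inv subgroup.m_closed[OF H]
                subgroup.m_inv_closed[OF H] mod_eq_dvd_iff)
        qed
        ultimately show ?thesis by blast
      qed
      then show ?thesis by blast
    qed
    then have "(\<lambda>h. ?K #> h) ` H \<subseteq> (\<lambda>r. {k \<in> H. f k mod int q = r}) ` {0..<int q}"
      using q by auto
    then show "finite ((\<lambda>h. ?K #> h) ` H)"
      by (meson finite_atLeastLessThan_int finite_imageI finite_subset)
  qed
qed

section \<open>Vanishing of the virtual first Betti number\<close>

theorem lemma4:
  fixes G :: "('a, 'b) monoid_scheme" and q :: nat
  assumes "prime q"
    and "finitely_generated_group G"
    and "\<And>N. N \<lhd> G \<Longrightarrow> finite (carrier (G Mod N)) \<Longrightarrow> coprime (order (G Mod N)) q"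
  shows "vanishing_virtual_first_betti G"
proof -
  interpret group G using assms(2) by (simp add: finitely_generated_group_def)
  have False if H: "subgroup H G" and fin: "finite (rcosets\<^bsub>G\<^esub> H)"
    and epi: "f \<in> epi (G\<lparr>carrier := H\<rparr>) integer_group" for H f
  proof -
    have f: "f \<in> hom (G\<lparr>carrier := H\<rparr>) integer_group" and "f ` H = UNIV"
      using epi by (auto simp: epi_def)
    then obtain t where t: "t \<in> H" "f t = 1" by (metis UNIV_I imageE)
    interpret f: group_hom "G\<lparr>carrier := H\<rparr>" integer_group f
      by (simp add: group_hom_def group_hom_axioms_def subgroup_imp_group[OF H] f)
    define K where "K = {h \<in> H. int q dvd f h}"
    have K: "subgroup K G" and finK: "finite (rcosets\<^bsub>G\<^esub> K)"
      unfolding K_def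
      using preimage_multiples_finite_index[OF H fin f prime_gt_0_nat[OF assms(1)]] .
    define N where "N = normal_core G K"
    have N: "N \<lhd> G" unfolding N_def using K by (rule normal_core_normal)
    have finN: "finite (carrier (G Mod N))"
      unfolding N_def using finite_rcosets_normal_core[OF K finK] by (simp add: FactGroup_def)
    let ?n = "order (G Mod N)"
    have "t [^]\<^bsub>G\<^esub> ?n \<in> N"
      using normal.pow_order_FactGroup_mem[OF N finN] t(1) subgroup.subset[OF H] by blast
    then have "int q dvd f (t [^]\<^bsub>G\<^esub> ?n)"
      using normal_core_subset[OF K] by (auto simp: N_def K_def)
    also have "f (t [^]\<^bsub>G\<^esub> ?n) = int ?n"
      using f.hom_nat_pow[of t ?n] t by (simp add: nat_pow_consistent[symmetric])
    finally have "q dvd ?n" by simp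
    then have "\<not> coprime ?n q"
      using assms(1) by (metis coprime_absorb_right not_prime_unit)
    then show False using assms(3)[OF N finN] by blast
  qed
  then show ?thesis
    by (auto simp: vanishing_virtual_first_betti_def vanishing_first_betti_def
        finite_index_subgroup_def)
qed

end
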